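(* Let $U\subset\mathbb{C}$ be a hyperbolic domain and let $f:U\to U$ be a holomorphic map such that $f^n\to\infty$ as $n\to\infty$ almost uniformly on $U$. If $\infty$ is an isolated point of the boundary of $U$ in $\overline{\mathbb{C}}$, then there is no simply connected absorbing domain $W$ in $U$ for $f$.
   Context: A domain $U\subset\mathbb{C}$ is hyperbolic if $\mathbb{C}\setminus U$ contains at least two points. $f^n$ is the $n$-th iterate and $\overline{\mathbb{C}}$ is the Riemann sphere. "Almost uniformly" means uniformly on compact subsets. Absorbing domain: a domain $W\subset U$ is absorbing in $U$ for $f$ if $f(W)\subset W$ and for every compact $K\subset U$ there is $n\ge 0$ with $f^n(K)\subset W$. *)

theory Defs
  imports "HOL-Complex_Analysis.Complex_Analysis"
begin

definition plane_domain :: "complex set \<Rightarrow> bool" where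
  "plane_domain U \<longleftrightarrow> open U \<and> connected U \<and> U \<noteq> {}"

definition hyperbolic_domain :: "complex set \<Rightarrow> bool" where
  "hyperbolic_domain U \<longleftrightarrow> plane_domain U \<and> (\<exists>a b. a \<noteq> b \<and> a \<in> - U \<and> b \<in> - U)"

(* A finite point z is represented by Some z, and the point at infinity by None. *)
abbreviation riemann_sphere :: "complex option topology" where
  "riemann_sphere \<equiv> Alexandroff_compactification (euclidean :: complex topology)"

definition isolated_point_in :: "'a topology \<Rightarrow> 'a \<Rightarrow> 'a set \<Rightarrow> bool" where
  "isolated_point_in X x S \<longleftrightarrow> x \<in> S \<and> (\<exists>V. openin X V \<and> V \<inter> S = {x})"

(* Uniform convergence on compact subsets of U to the constant map p into the sphere.  As the
   limit is constant and the sphere is compact Hausdorff, uniformity (for the spherical metric)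
   only involves the neighbourhoods of p. *)
definition almost_uniformly_tendsto ::
    "(nat \<Rightarrow> complex \<Rightarrow> complex) \<Rightarrow> complex option \<Rightarrow> complex set \<Rightarrow> bool" where
  "almost_uniformly_tendsto g p U \<longleftrightarrow>
     (\<forall>K V. compact K \<and> K \<subseteq> U \<and> openin riemann_sphere V \<and> p \<in> V \<longrightarrow>
        (\<forall>\<^sub>F n in sequentially. \<forall>z\<in>K. Some (g n z) \<in> V))"

lemma almost_uniformly_tendsto_infinity_iff:
  "almost_uniformly_tendsto g None U \<longleftrightarrow>
     (\<forall>K R. compact K \<and> K \<subseteq> U \<longrightarrow> (\<forall>\<^sub>F n in sequentially. \<forall>z\<in>K. R < norm (g n z)))"
    (is "?L \<longleftrightarrow> ?R")
proof
  assume L: ?L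
  show ?R
  proof (intro allI impI)
    fix K :: "complex set" and R :: real
    assume K: "compact K \<and> K \<subseteq> U"
    have "openin riemann_sphere (insert None (Some ` (UNIV - cball 0 R)))"
      unfolding openin_Alexandroff_compactification
      by (intro disjI2 exI[of _ "cball 0 R"]) simp
    then have "\<forall>\<^sub>F n in sequentially. \<forall>z\<in>K. Some (g n z) \<in> insert None (Some ` (UNIV - cball 0 R))"
      using L K unfolding almost_uniformly_tendsto_def by blast
    then show "\<forall>\<^sub>F n in sequentially. \<forall>z\<in>K. R < norm (g n z)"
      by (rule eventually_mono) force
  qed
next
  assume R: ?R
  show ?L
    unfolding almost_uniformly_tendsto_def
  proof (intro allI impI, elim conjE)
    fix K :: "complex set" and V
    assume K: "compact K" "K \<subseteq> U" and V: "openin riemann_sphere V" "None \<in> V"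
    obtain C :: "complex set" where C: "compact C" "V = insert None (Some ` (UNIV - C))"
      using V by (auto simp: openin_Alexandroff_compactification)
    obtain B where B: "\<And>z. z \<in> C \<Longrightarrow> norm z \<le> B"
      using C(1) compact_imp_bounded bounded_iff by metis
    have "\<forall>\<^sub>F n in sequentially. \<forall>z\<in>K. B < norm (g n z)"
      using R K by blast
    then show "\<forall>\<^sub>F n in sequentially. \<forall>z\<in>K. Some (g n z) \<in> V"
      by (rule eventually_mono) (use B C in force)
  qed
qed

definition absorbing_domain :: "complex set \<Rightarrow> (complex \<Rightarrow> complex) \<Rightarrow> complex set \<Rightarrow> bool" where
  "absorbing_domain U f W \<longleftrightarrow>
     plane_domain W \<and> W \<subseteq> U \<and> f ` W \<subseteq> W \<and>
     (\<forall>K. compact K \<and> K \<subseteq> U \<longrightarrow> (\<exists>n. (f ^^ n) ` K \<subseteq> W))"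

end

theory Submission
  imports Defs
begin

text \<open>
  Since \<open>\<infinity>\<close> is isolated in the boundary, \<open>U\<close> contains a set \<open>{z. R < norm z}\<close>, and by the great
  Picard theorem \<open>f\<close>, which omits two values, has a limit at \<open>\<infinity>\<close>.  A finite limit would make \<open>f\<close>
  bounded near \<open>\<infinity>\<close>, so that no orbit could escape; hence \<open>f\<close>, and every iterate of \<open>f\<close>, tends to
  \<open>\<infinity>\<close> at \<open>\<infinity>\<close>.  If \<open>W\<close> is absorbing, some iterate maps a large circle into \<open>W\<close>.  The image curve
  winds a nonzero number of times around any point omitted by \<open>U\<close>, because the iterate has a pole
  at \<open>\<infinity>\<close> and omits that point.  This is impossible in a simply connected \<open>W\<close>.
\<close>

text \<open>An isolating neighbourhood of infinity contains the exterior \<open>E\<close> of a disc.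
  \<open>E\<close> is connected, meets \<open>U\<close> and misses the frontier of \<open>U\<close>,
  so it cannot leave \<open>U\<close>.\<close>

lemma exterior_subset_of_isolated_infinity:
  assumes "open U"
    and "isolated_point_in riemann_sphere None (riemann_sphere frontier_of (Some ` U))"
  obtains R where "0 < R" and "- cball 0 R \<subseteq> U"
proof -
  obtain V where None_frontier: "None \<in> riemann_sphere frontier_of (Some ` U)"
    and V: "openin riemann_sphere V" "V \<inter> riemann_sphere frontier_of (Some ` U) = {None}"
    using assms(2) unfolding isolated_point_in_def by blast
  then have "None \<in> V" by blast
  then obtain C :: "complex set" where C: "compact C" "V = insert None (Some ` (UNIV - C))"
    using V(1) by (auto simp: openin_Alexandroff_compactification)
  obtain R where R: "0 < R" "C \<subseteq> cball 0 R"
    using bounded_subset_ballD[OF compact_imp_bounded[OF C(1)], of 0] ball_subset_cball by (meson order_trans)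
  define E where "E = - cball (0::complex) R"
  have "connected E"
    unfolding E_def by (rule connected_complement_bounded_convex) auto
  have "openin riemann_sphere (insert None (Some ` E))"
    unfolding openin_Alexandroff_compactification E_def
    by (intro disjI2 exI[of _ "cball 0 R"]) (simp add: Compl_eq_Diff_UNIV)
  then have "\<exists>y\<in>Some ` U. y \<in> insert None (Some ` E)"
    using None_frontier unfolding frontier_of_def closure_of_def by blast
  then have "E \<inter> U \<noteq> {}" by blast
  have "E \<inter> frontier U = {}"
  proof (rule ccontr)
    assume "E \<inter> frontier U \<noteq> {}"
    then obtain z where z: "z \<in> E" "z \<in> frontier U" by blast
    then have "z \<in> closure U" "z \<notin> U"
      using assms(1) by (auto simp: frontier_def interior_open)
    \<comment> \<open>A frontier point in the plane stays one in the sphere: \<open>Some\<close> is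
      continuous, so neighbourhoods pull back to open sets.\<close>
    have "Some z \<in> riemann_sphere closure_of (Some ` U)"
      unfolding in_closure_of
    proof (intro conjI allI impI)
      show "Some z \<in> topspace riemann_sphere" by simp
    next
      fix T
      assume T: "Some z \<in> T \<and> openin riemann_sphere T"
      have "open (Some -` T)"
        using openin_continuous_map_preimage[OF continuous_map_Some, of euclidean T] T
        by (simp add: vimage_def)
      then have "Some -` T \<inter> U \<noteq> {}"
        using T \<open>z \<in> closure U\<close> open_Int_closure_eq_empty[of "Some -` T" U] by blast
      then show "\<exists>y. y \<in> Some ` U \<and> y \<in> T" by blast
    qed
    moreover have "Some z \<notin> riemann_sphere interior_of (Some ` U)"
      using interior_of_subset[of riemann_sphere "Some ` U"] \<open>z \<notin> U\<close> by blast
    moreover have "Some z \<in> V"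
      using z(1) R(2) unfolding C(2) E_def by blast
    ultimately show False
      using V(2) unfolding frontier_of_def by blast
  qed
  then have "E \<subseteq> U"
    using connected_Int_frontier[OF \<open>connected E\<close> \<open>E \<inter> U \<noteq> {}\<close>] by blast
  then show thesis
    using that R(1) by (simp add: E_def)
qed

text \<open>The inversion \<open>w\<close> to \<open>1/w\<close> moves the singularity to 0, where
  great Picard gives a finite limit for the function or for its reciprocal.\<close>

lemma great_Picard_at_infinity:
  fixes f :: "complex \<Rightarrow> complex"
  assumes "0 < R" "f holomorphic_on - cball 0 R" "a \<noteq> b"
    and omits: "\<And>z. z \<in> - cball 0 R \<Longrightarrow> f z \<noteq> a \<and> f z \<noteq> b"
  obtains l where "(f \<longlongrightarrow> l) at_infinity" | "filterlim f at_infinity at_infinity"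
proof -
  \<comment> \<open>Subtracting \<open>a\<close> makes 0 an omitted value, so the reciprocal is a
    genuine one and never vanishes.\<close>
  define g where "g = (\<lambda>w. f (inverse w) - a)"
  have out: "inverse w \<in> - cball 0 R" if "w \<in> ball 0 (1/R) - {0}" for w :: complex
    using that \<open>0 < R\<close> by (simp add: norm_inverse field_simps norm_divide)
  have "g holomorphic_on ball 0 (1/R) - {0}"
    unfolding g_def
  proof (intro holomorphic_intros)
    show "(\<lambda>w. f (inverse w)) holomorphic_on ball 0 (1/R) - {0}"
      using out by (intro holomorphic_on_compose_gen[OF _ assms(2), unfolded o_def] holomorphic_intros) auto
  qed
  moreover have "g w \<noteq> 0 \<and> g w \<noteq> b - a" if "w \<in> ball 0 (1/R) - {0}" for w
    using omits[OF out[OF that]] by (simp add: g_def)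
  moreover have "0 \<noteq> b - a" using \<open>a \<noteq> b\<close> by simp
  ultimately obtain l where "(g \<longlongrightarrow> l) (at 0) \<or> ((inverse \<circ> g) \<longlongrightarrow> l) (at 0)"
    using great_Picard[of "ball 0 (1/R)" 0 0 "b - a" g] \<open>0 < R\<close> by auto
  then have "((\<lambda>z. f z - a) \<longlongrightarrow> l) at_infinity \<or> ((\<lambda>z. inverse (f z - a)) \<longlongrightarrow> l) at_infinity"
    by (simp add: lim_at_infinity_0 g_def o_def)
  then consider "((\<lambda>z. f z - a) \<longlongrightarrow> l) at_infinity"
    | "((\<lambda>z. inverse (f z - a)) \<longlongrightarrow> l) at_infinity" "l \<noteq> 0"
    | "((\<lambda>z. inverse (f z - a)) \<longlongrightarrow> 0) at_infinity"
    by blast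
  then show thesis
  proof cases
    case 1
    show ?thesis
      by (rule that(1)[of "l + a"]) (use tendsto_add[OF 1 tendsto_const[of a]] in simp)
  next
    case 2
    show ?thesis
      by (rule that(1)[of "inverse l + a"])
        (use tendsto_add[OF tendsto_inverse[OF 2] tendsto_const[of a]] in simp)
  next
    case 3
    \<comment> \<open>Since \<open>inverse 0 = 0\<close>, a reciprocal tending to 0 signals a pole
      only if it is eventually nonzero.\<close>
    have "\<forall>\<^sub>F z in at_infinity. inverse (f z - a) \<noteq> 0"
      unfolding eventually_at_infinity using omits by (intro exI[of _ "R + 1"]) auto
    then have "filterlim (\<lambda>z. f z - a) at_infinity at_infinity"
      using 3 by (simp flip: filterlim_inverse_at_iff add: filterlim_at)
    then have "filterlim (\<lambda>z. a + (f z - a)) at_infinity at_infinity"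
      by (rule tendsto_add_filterlim_at_infinity[OF tendsto_const])
    then show ?thesis
      using that(2) by simp
  qed
qed

text \<open>By the argument principle the integral of \<open>k'/k\<close> over the circle is 2 pi i
  times the order of the zero at 0. A logarithm near the circle would be a primitive of
  \<open>k'/k\<close> and make this integral 0.\<close>

lemma no_logarithm_around_unique_zero:
  assumes "k holomorphic_on ball 0 r" "k 0 = 0"
    and nz: "\<And>w. w \<in> ball 0 r - {0} \<Longrightarrow> k w \<noteq> 0"
    and "0 < s" "s < r" and "open S" "sphere 0 s \<subseteq> S"
    and "L holomorphic_on S" and exp: "\<And>w. w \<in> S \<Longrightarrow> k w = exp (L w)"
  shows False
proof -
  \<comment> \<open>The set has the shape required by \<open>argument_principle\<close>, taken with
    no poles and weight 1.\<close>
  have zeros: "{w \<in> ball 0 r. k w = 0 \<or> w \<in> {}} = {0}"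
    using assms by auto
  have path: "path_image (circlepath 0 s) \<subseteq> ball 0 r - {0}"
    using \<open>0 < s\<close> \<open>s < r\<close> by (auto simp: path_image_circlepath)
  have "contour_integral (circlepath 0 s) (\<lambda>w. deriv k w * 1 / k w)
      = 2 * pi * \<i> * (\<Sum>p\<in>{w \<in> ball 0 r. k w = 0 \<or> w \<in> {}}.
          winding_number (circlepath 0 s) p * 1 * zorder k p)"
  proof (rule argument_principle)
    show "\<forall>z. z \<notin> ball 0 r \<longrightarrow> winding_number (circlepath 0 s) z = 0"
    proof (intro allI impI)
      fix z :: complex
      assume "z \<notin> ball 0 r"
      then show "winding_number (circlepath 0 s) z = 0"
        using \<open>0 < s\<close> \<open>s < r\<close>
        by (intro winding_number_zero_outside[of _ "cball 0 s"])
          (auto simp: path_image_circlepath)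
    qed
  qed (use assms path zeros in auto)
  then have "contour_integral (circlepath 0 s) (\<lambda>w. deriv k w / k w) = 2 * pi * \<i> * zorder k 0"
    unfolding zeros using \<open>0 < s\<close> by (simp add: winding_number_circlepath_centre)
  moreover have "((\<lambda>w. deriv k w / k w) has_contour_integral 0) (circlepath 0 s)"
  proof (rule Cauchy_theorem_primitive)
    fix w assume "w \<in> S"
    have L: "(L has_field_derivative deriv L w) (at w)"
      using \<open>L holomorphic_on S\<close> \<open>open S\<close> \<open>w \<in> S\<close> holomorphic_derivI by blast
    have "((\<lambda>w. exp (L w)) has_field_derivative exp (L w) * deriv L w) (at w)"
      by (rule DERIV_chain2[OF DERIV_exp L])
    then have "(k has_field_derivative exp (L w) * deriv L w) (at w)"
      by (rule DERIV_cong_ev[THEN iffD1, rotated -1])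
        (use exp \<open>open S\<close> \<open>w \<in> S\<close> in \<open>auto simp: eventually_nhds\<close>)
    then have "deriv k w = k w * deriv L w"
      using exp[OF \<open>w \<in> S\<close>] by (simp add: DERIV_imp_deriv)
    then have "deriv k w / k w = deriv L w"
      using exp[OF \<open>w \<in> S\<close>] by simp
    then show "(L has_field_derivative deriv k w / k w) (at w within S)"
      using L by (simp add: has_field_derivative_at_within)
  qed (use assms in \<open>auto simp: path_image_circlepath\<close>)
  ultimately have "zorder k 0 = 0"
    by (simp add: contour_integral_unique)
  moreover have "zorder k 0 > 0"
  proof -
    \<comment> \<open>The order of a zero is positive only if \<open>k\<close> does not vanish
      identically.\<close>
    have "\<exists>w\<in>ball 0 r. k w \<noteq> 0"
      using nz[of "of_real s"] \<open>0 < s\<close> \<open>s < r\<close> by (intro bexI[of _ "of_real s"]) auto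
    then show ?thesis
      using zorder_exist_zero[of k "ball 0 r" 0] assms by auto
  qed
  ultimately show False by simp
qed

text \<open>After inversion, \<open>1/(h - a)\<close> has a single zero, at 0. A logarithm of
  \<open>w - a\<close> on \<open>W\<close> would pull back to a logarithm of it around a circle,
  contrary to the previous lemma.\<close>

lemma circle_not_mapped_into_simply_connected:
  assumes "0 < R" "h holomorphic_on - cball 0 R" "filterlim h at_infinity at_infinity"
    and omits: "\<And>z. z \<in> - cball 0 R \<Longrightarrow> h z \<noteq> a"
    and "open W" "simply_connected W" "a \<notin> W" and "R < \<rho>"
  shows "\<not> h ` sphere 0 \<rho> \<subseteq> W"
proof
  assume W: "h ` sphere 0 \<rho> \<subseteq> W"
  obtain G where G: "G holomorphic_on W" "\<And>w. w \<in> W \<Longrightarrow> w - a = exp (G w)"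
  proof (rule simply_connected_imp_holomorphic_log)
    show "(\<lambda>w. w - a) holomorphic_on W" by (intro holomorphic_intros)
    show "w - a \<noteq> 0" if "w \<in> W" for w using that \<open>a \<notin> W\<close> by auto
  qed (use assms open_imp_locally_path_connected in auto)
  define D where "D = ball (0::complex) (1/R)"
  define q where "q = (\<lambda>w. h (inverse w))"
  \<comment> \<open>The value 0 fills the removable singularity, because \<open>h\<close> tends to
    infinity.\<close>
  define k where "k = (\<lambda>w. if w = 0 then 0 else inverse (q w - a))"
  have out: "inverse w \<in> - cball 0 R" if "w \<in> D - {0}" for w :: complex
    using that \<open>0 < R\<close> by (simp add: D_def norm_inverse field_simps norm_divide)
  have q: "q holomorphic_on D - {0}"
    unfolding q_def
    using out by (intro holomorphic_on_compose_gen[OF _ assms(2), unfolded o_def] holomorphic_intros) auto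
  have q_omits: "q w \<noteq> a" if "w \<in> D - {0}" for w
    using omits[OF out[OF that]] by (simp add: q_def)
  have "(\<lambda>w. inverse (q w - a)) holomorphic_on D - {0}"
    using q_omits by (intro holomorphic_intros q) auto
  then have "k holomorphic_on D - {0}"
    by (rule holomorphic_transform) (auto simp: k_def)
  moreover have "(k \<longlongrightarrow> k 0) (at 0 within D)"
  proof -
    have "filterlim q at_infinity (at 0)"
      unfolding q_def using assms(3) filterlim_inverse_at_infinity by (rule filterlim_compose)
    then have "filterlim (\<lambda>w. - a + q w) at_infinity (at 0)"
      by (rule tendsto_add_filterlim_at_infinity[OF tendsto_const])
    then have "((\<lambda>w. inverse (q w - a)) \<longlongrightarrow> 0) (at 0)"
      using filterlim_compose[OF tendsto_inverse_0] by fastforce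
    then have "(k \<longlongrightarrow> 0) (at 0)"
      by (rule Lim_transform_eventually) (auto simp: k_def eventually_at_filter)
    then show ?thesis
      unfolding k_def by (auto intro: tendsto_within_subset)
  qed
  ultimately have "k holomorphic_on D"
    by (intro no_isolated_singularity'[of "{0}" k D]) (auto simp: D_def)
  \<comment> \<open>This is where \<open>G\<close> composed with \<open>q\<close> is holomorphic; 0
    is left out because \<open>q 0\<close> is merely \<open>h 0\<close>.\<close>
  define S where "S = (D - {0}) \<inter> q -` W"
  have "open S"
    unfolding S_def
    by (rule continuous_open_preimage[OF holomorphic_on_imp_continuous_on[OF q] _ \<open>open W\<close>])
      (auto simp: D_def)
  have "sphere 0 (1/\<rho>) \<subseteq> S"
  proof
    fix w :: complex
    assume "w \<in> sphere 0 (1/\<rho>)"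
    then have w: "norm w = 1/\<rho>" by simp
    have "w \<in> D - {0}"
      using w frac_less2[of 1 1 R \<rho>] \<open>0 < R\<close> \<open>R < \<rho>\<close> by (auto simp: D_def)
    moreover have "inverse w \<in> sphere 0 \<rho>"
      using w by (simp add: norm_inverse)
    ultimately show "w \<in> S"
      using W by (auto simp: S_def q_def)
  qed
  show False
  proof (rule no_logarithm_around_unique_zero)
    show "k holomorphic_on ball 0 (1/R)" using \<open>k holomorphic_on D\<close> by (simp add: D_def)
    show "k w \<noteq> 0" if "w \<in> ball 0 (1/R) - {0}" for w
      using q_omits[of w] that by (simp add: k_def D_def)
    \<comment> \<open>The sign is negative because \<open>k\<close> is the reciprocal of
      \<open>q - a\<close>.\<close>
    show "(\<lambda>w. - G (q w)) holomorphic_on S"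
    proof (intro holomorphic_intros)
      show "(\<lambda>w. G (q w)) holomorphic_on S"
        by (rule holomorphic_on_compose_gen[OF _ G(1), unfolded o_def])
          (auto simp: S_def intro: holomorphic_on_subset[OF q])
    qed
    show "k w = exp (- G (q w))" if "w \<in> S" for w
      using that G(2)[of "q w"] by (auto simp: S_def k_def exp_minus)
    show "1/\<rho> < 1/R" "0 < 1/\<rho>"
      using \<open>0 < R\<close> \<open>R < \<rho>\<close> by (auto simp: field_simps)
    show "k 0 = 0" by (simp add: k_def)
  qed fact+
qed

lemma funpow_image_subset:
  assumes "f ` U \<subseteq> U"
  shows "(f ^^ n) ` U \<subseteq> U"
  using assms by (induction n) auto

lemma holomorphic_on_funpow:
  assumes "f holomorphic_on U" "f ` U \<subseteq> U"
  shows "(f ^^ n) holomorphic_on U"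
proof (induction n)
  case 0
  then show ?case by (simp add: id_def)
next
  case (Suc n)
  then show ?case
    using holomorphic_on_compose_gen[OF Suc assms(1) funpow_image_subset[OF assms(2)]] by (simp add: o_def)
qed

lemma filterlim_funpow:
  assumes "filterlim f F F"
  shows "filterlim (f ^^ n) F F"
proof (induction n)
  case 0
  then show ?case by (simp add: id_def filterlim_ident)
next
  case (Suc n)
  then show ?case
    using filterlim_compose[OF assms Suc] by (simp add: o_def)
qed

text \<open>Applying \<open>f\<close> to the orbit only shifts it by one index, so a finite limit of
  \<open>f\<close> at infinity would also be the limit of the escaping orbit.\<close>

lemma no_finite_limit_of_escaping_orbit:
  fixes f :: "complex \<Rightarrow> complex"
  assumes "filterlim (\<lambda>n. (f ^^ n) z) at_infinity sequentially"
  shows "\<not> (f \<longlongrightarrow> l) at_infinity"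
proof
  assume "(f \<longlongrightarrow> l) at_infinity"
  then have "(\<lambda>n. f ((f ^^ n) z)) \<longlonglongrightarrow> l"
    using assms by (rule filterlim_compose)
  then have "(\<lambda>n. (f ^^ n) z) \<longlonglongrightarrow> l"
    by (simp add: LIMSEQ_imp_Suc)
  then show False
    using assms not_tendsto_and_filterlim_at_infinity sequentially_bot by blast
qed

theorem proposition14:
  fixes U :: "complex set" and f :: "complex \<Rightarrow> complex"
  assumes "hyperbolic_domain U"
    and "f holomorphic_on U"
    and "f ` U \<subseteq> U"
    and "almost_uniformly_tendsto (\<lambda>n. f ^^ n) None U"
    and "isolated_point_in riemann_sphere None (riemann_sphere frontier_of (Some ` U))"
  shows "\<not> (\<exists>W. absorbing_domain U f W \<and> simply_connected W)"
proof
  assume "\<exists>W. absorbing_domain U f W \<and> simply_connected W"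
  then obtain W where "absorbing_domain U f W" "simply_connected W"
    by blast
  then have W: "open W" "W \<subseteq> U" "simply_connected W"
    and absorbs: "\<And>K. compact K \<Longrightarrow> K \<subseteq> U \<Longrightarrow> \<exists>n. (f ^^ n) ` K \<subseteq> W"
    by (simp_all add: absorbing_domain_def plane_domain_def)
  obtain a b where ab: "a \<noteq> b" "a \<notin> U" "b \<notin> U" and "open U" "U \<noteq> {}"
    using assms(1) unfolding hyperbolic_domain_def plane_domain_def by blast
  obtain R where R: "0 < R" "- cball 0 R \<subseteq> U"
    using exterior_subset_of_isolated_infinity[OF \<open>open U\<close> assms(5)] .
  obtain z where "z \<in> U" using \<open>U \<noteq> {}\<close> by blast
  have orbit: "filterlim (\<lambda>n. (f ^^ n) z) at_infinity sequentially"
    unfolding filterlim_at_infinity[OF order_refl]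
  proof (intro allI impI)
    fix r :: real
    have "\<forall>\<^sub>F n in sequentially. \<forall>w\<in>{z}. r < norm ((f ^^ n) w)"
      using assms(4)[unfolded almost_uniformly_tendsto_infinity_iff, rule_format, of "{z}" r]
        \<open>z \<in> U\<close> by simp
    then show "\<forall>\<^sub>F n in sequentially. r \<le> norm ((f ^^ n) z)"
      by (rule eventually_mono) simp
  qed
  have "f holomorphic_on - cball 0 R"
    using assms(2) R(2) by (rule holomorphic_on_subset)
  moreover have "f w \<noteq> a \<and> f w \<noteq> b" if "w \<in> - cball 0 R" for w
  proof -
    have "f w \<in> U" using that R(2) assms(3) by blast
    then show ?thesis using ab by metis
  qed
  \<comment> \<open>Of the two alternatives in Picard's theorem, the escaping orbit of
    \<open>z\<close> excludes the finite limit.\<close>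
  ultimately have lim: "filterlim f at_infinity at_infinity"
    using great_Picard_at_infinity[OF R(1) _ ab(1)] no_finite_limit_of_escaping_orbit[OF orbit]
    by metis
  \<comment> \<open>Any radius above \<open>R\<close> would do: the circle is a compact subset of
    \<open>U\<close>, so some iterate carries it into \<open>W\<close>.\<close>
  have "sphere 0 (R + 1) \<subseteq> U"
    using R by auto
  then obtain n where n: "(f ^^ n) ` sphere 0 (R + 1) \<subseteq> W"
    using absorbs[OF compact_sphere] by blast
  have "\<not> (f ^^ n) ` sphere 0 (R + 1) \<subseteq> W"
  proof (rule circle_not_mapped_into_simply_connected)
    show "(f ^^ n) holomorphic_on - cball 0 R"
      using holomorphic_on_funpow[OF assms(2,3)] R(2) by (rule holomorphic_on_subset)
    show "filterlim (f ^^ n) at_infinity at_infinity"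
      by (rule filterlim_funpow[OF lim])
    show "(f ^^ n) w \<noteq> a" if "w \<in> - cball 0 R" for w
    proof -
      have "(f ^^ n) w \<in> U"
        using that R(2) funpow_image_subset[OF assms(3), of n] by blast
      then show ?thesis using ab(2) by metis
    qed
    show "a \<notin> W" using W(2) ab(2) by blast
  qed (use R(1) W in auto)
  then show False using n by contradiction
qed

end
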